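(* Let $(\boldsymbol Z,\boldsymbol W)$ be random elements of $\mathcal Z\times\mathcal W$ such that $\boldsymbol Z$ is independent of $\boldsymbol W$ and the density $\pi$ of $\boldsymbol Z$ is known and positive everywhere on $\mathcal Z$. Let $K\ge 1$. For $k\in[K]$ let $V^{(k)}=v^{(k)}(\boldsymbol Z)$, where $v^{(k)}$ is a function on $\mathcal Z$ taking finitely many values, and write $\boldsymbol V^{[k]}=(V^{(1)},\dots,V^{(k)})$. For each $k\in[K]$ let $t^{(k)}(\boldsymbol V^{[k]},\boldsymbol W)$ be a real-valued test statistic, i.e. a measurable function of $\boldsymbol V^{[k]}$ and $\boldsymbol W$, and define $$P^{(k)}=p^{(k)}(\boldsymbol V^{[k]},\boldsymbol W)=\mathbb P\left\{t^{(k)}(\boldsymbol V^{*[k]},\boldsymbol W)\le t^{(k)}(\boldsymbol V^{[k]},\boldsymbol W)\,\middle|\,\boldsymbol V^{*[k-1]}=\boldsymbol V^{[k-1]},\boldsymbol Z,\boldsymbol W\right\},$$ where $V^{*(k)}=v^{(k)}(\boldsymbol Z^* )$, $\boldsymbol V^{*[k]}=(V^{*(1)},\dots,V^{*(k)})$, and $\boldsymbol Z^*$ is a copy of $\boldsymbol Z$ (same distribution) independent of $(\boldsymbol Z,\boldsymbol W)$; for $k=1$ the conditioning on $\boldsymbol V^{*[0]}=\boldsymbol V^{[0]}$ is vacuous. Then $P^{(1)},\dots,P^{(K)}$ are valid, i.e. $\mathbb P(P^{(k)}\le\alpha)\le\alpha$ for all $\alpha\in[0,1]$ and $k\in[K]$,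 and nearly independent in the sense that, for all $\alpha^{(1)},\dots,\alpha^{(K)}\in[0,1]$, $$\mathbb P\left(P^{(1)}\le\alpha^{(1)},\dots,P^{(K)}\le\alpha^{(K)}\mid\boldsymbol W\right)\le\prod_{k=1}^K\alpha^{(k)}$$ (almost surely).
   Context: $[K]=\{1,\dots,K\}$. $\boldsymbol Z$ is the random treatment assignment with values in the space $\mathcal Z$; $\boldsymbol W=(\boldsymbol Y(\boldsymbol z):\boldsymbol z\in\mathcal Z)\in\mathcal W$ is the (random) potential outcomes schedule. All functions are measurable. Since the $v^{(k)}$ take finitely many values, conditioning on $\boldsymbol V^{*[k-1]}=\boldsymbol V^{[k-1]}$ is elementary conditioning on the event $\{\boldsymbol Z^*\in\mathcal S\}$, where $\mathcal S=\{\boldsymbol z: v^{(j)}(\boldsymbol z)=V^{(j)},\,j\le k-1\}$; events of probability zero may be ignored. *)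

theory Defs
  imports "HOL-Probability.Probability"
begin

text \<open>The tuple \<open>(v\<^sup>1(z), \<dots>, v\<^sup>k(z))\<close> as a list; it is empty for \<open>k = 0\<close>. All \<open>v\<^sup>j\<close>
  share one value type, which is no restriction as a sum type can be used.\<close>

definition vtuple :: "(nat \<Rightarrow> 'z \<Rightarrow> 'v) \<Rightarrow> nat \<Rightarrow> 'z \<Rightarrow> 'v list" where
  "vtuple v k z = map (\<lambda>j. v j z) [1..<Suc k]"

text \<open>The library's \<open>indep_var\<close> requires both random variables to have the same value type; this
  is the condition it unfolds to, without that restriction.\<close>

definition indep_elements ::
  "'a measure \<Rightarrow> 'b measure \<Rightarrow> ('a \<Rightarrow> 'b) \<Rightarrow> 'c measure \<Rightarrow> ('a \<Rightarrow> 'c) \<Rightarrow> bool" where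
  "indep_elements M N X Q Y \<longleftrightarrow>
     X \<in> measurable M N \<and> Y \<in> measurable M Q \<and>
     prob_space.indep_set M {X -` A \<inter> space M | A. A \<in> sets N} {Y -` B \<inter> space M | B. B \<in> sets Q}"

definition generated_by :: "'a measure \<Rightarrow> ('a \<Rightarrow> 'b) \<Rightarrow> 'b measure \<Rightarrow> 'a measure" where
  "generated_by M X N = vimage_algebra (space M) X N"

definition cond_prob_sigma :: "'a measure \<Rightarrow> 'a measure \<Rightarrow> ('a \<Rightarrow> bool) \<Rightarrow> 'a \<Rightarrow> real" where
  "cond_prob_sigma M F A = real_cond_exp M F (indicator {x \<in> space M. A x})"

text \<open>Conditional probability of \<open>A\<close> given both the event \<open>B\<close> and the sub-\<open>\<sigma>\<close>-algebra \<open>F\<close>: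
  elementary conditioning on \<open>B\<close> under the conditional law given \<open>F\<close>. It is determined almost
  surely on the set where the conditional probability of \<open>B\<close> given \<open>F\<close> is positive.\<close>

definition cond_prob_event_sigma ::
  "'a measure \<Rightarrow> 'a measure \<Rightarrow> ('a \<Rightarrow> bool) \<Rightarrow> ('a \<Rightarrow> bool) \<Rightarrow> 'a \<Rightarrow> real" where
  "cond_prob_event_sigma M F A B x =
     cond_prob_sigma M F (\<lambda>y. A y \<and> B y) x / cond_prob_sigma M F B x"

text \<open>\<open>pvalue M N Q Z W Zs v t k\<close> is the random variable \<open>P\<^sup>k\<close>; \<open>N\<close> and \<open>Q\<close> carry the measurable
  structures of the treatment space and of the space of outcome schedules, and \<open>Zs\<close> is the
  independent copy \<open>Z\<^sup>*\<close>.\<close>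

definition pvalue ::
  "'a measure \<Rightarrow> 'z measure \<Rightarrow> 'w measure \<Rightarrow> ('a \<Rightarrow> 'z) \<Rightarrow> ('a \<Rightarrow> 'w) \<Rightarrow> ('a \<Rightarrow> 'z) \<Rightarrow>
   (nat \<Rightarrow> 'z \<Rightarrow> 'v) \<Rightarrow> (nat \<Rightarrow> 'v list \<Rightarrow> 'w \<Rightarrow> real) \<Rightarrow> nat \<Rightarrow> 'a \<Rightarrow> real" where
  "pvalue M N Q Z W Zs v t k =
     cond_prob_event_sigma M (generated_by M (\<lambda>x. (Z x, W x)) (N \<Otimes>\<^sub>M Q))
       (\<lambda>x. t k (vtuple v k (Zs x)) (W x) \<le> t k (vtuple v k (Z x)) (W x))
       (\<lambda>x. vtuple v (k - 1) (Zs x) = vtuple v (k - 1) (Z x))"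

text \<open>The function \<open>p\<^sup>k\<close> of a value \<open>vs\<close> of the first \<open>k\<close> variables and a value \<open>w\<close> of the schedule:
  \<open>Z\<close> and \<open>W\<close> are frozen and only \<open>Z\<^sup>*\<close> is random.\<close>

definition pvalue_fun ::
  "'a measure \<Rightarrow> ('a \<Rightarrow> 'z) \<Rightarrow> (nat \<Rightarrow> 'z \<Rightarrow> 'v) \<Rightarrow> (nat \<Rightarrow> 'v list \<Rightarrow> 'w \<Rightarrow> real) \<Rightarrow>
   nat \<Rightarrow> 'v list \<Rightarrow> 'w \<Rightarrow> real" where
  "pvalue_fun M Zs v t k vs w =
     \<P>(y in M. t k (vtuple v k (Zs y)) w \<le> t k vs w \<bar>
               vtuple v (k - 1) (Zs y) = take (k - 1) vs)"

end

theory Submission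
  imports Defs
begin

text \<open>Fix the outcome schedule \<open>w\<close>; only the law of the treatment then matters. On an event where
  the first \<open>k - 1\<close> variables are constant, the \<open>k\<close>-th p-value is an ordinary p-value of a finitely
  valued statistic under the conditional law, hence it is at most \<open>\<alpha>\<close> with conditional probability
  at most \<open>\<alpha>\<close>. The earlier p-values are constant on such an event, so induction on \<open>k\<close> gives the
  product bound for every fixed \<open>w\<close>. Since the treatment is independent of the schedule,
  conditioning on the schedule amounts to fixing \<open>w\<close>.\<close>

section \<open>Tuples of finitely valued maps\<close>

lemma vtuple_Suc: "vtuple v (Suc k) z = vtuple v k z @ [v (Suc k) z]"
  by (simp add: vtuple_def)

lemma take_vtuple: "j \<le> k \<Longrightarrow> take j (vtuple v k z) = vtuple v j z"
  by (simp add: vtuple_def take_map take_upt del: upt_Suc)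

lemma vtuple_eq_mono: "vtuple v k y = vtuple v k z \<Longrightarrow> j \<le> k \<Longrightarrow> vtuple v j y = vtuple v j z"
  by (metis take_vtuple)

text \<open>The target is the counting space on the range, not on all lists. The range is finite, so
  only preimages of singletons have to be measurable, and for a longer tuple these are intersections
  of two known ones.\<close>

lemma measurable_vtuple:
  assumes "\<And>j. j \<in> {1..k} \<Longrightarrow> v j \<in> measurable N (count_space UNIV)"
    and "\<And>j. j \<in> {1..k} \<Longrightarrow> finite (v j ` space N)"
  shows "finite (vtuple v k ` space N) \<and>
    vtuple v k \<in> measurable N (count_space (vtuple v k ` space N))"
  using assms
proof (induction k)
  case 0
  have "finite (vtuple v 0 ` space N)"
    by (rule finite_subset[of _ "{[]}"]) (auto simp: vtuple_def)
  moreover have "vtuple v 0 -` {a} \<inter> space N \<in> sets N" for a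
    by (cases "a = []") (simp_all add: vtuple_def vimage_def)
  ultimately show ?case
    by (auto simp: measurable_count_space_eq2)
next
  case (Suc k)
  then have fin: "finite (vtuple v k ` space N)"
    and meas: "vtuple v k \<in> measurable N (count_space (vtuple v k ` space N))"
    by auto
  have fin': "finite (vtuple v (Suc k) ` space N)"
    by (rule finite_subset[of _ "(\<lambda>(a, b). a @ [b]) ` (vtuple v k ` space N \<times> v (Suc k) ` space N)"])
      (auto simp: vtuple_Suc fin Suc.prems)
  have "vtuple v (Suc k) -` {vtuple v (Suc k) z} \<inter> space N \<in> sets N" if "z \<in> space N" for z
  proof -
    have "vtuple v (Suc k) -` {vtuple v (Suc k) z} \<inter> space N =
        (vtuple v k -` {vtuple v k z} \<inter> space N) \<inter> (v (Suc k) -` {v (Suc k) z} \<inter> space N)"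
      by (auto simp: vtuple_Suc)
    also have "\<dots> \<in> sets N"
      using that Suc.prems(1)[of "Suc k"]
      by (intro sets.Int measurable_sets[OF meas] measurable_sets[of "v (Suc k)" N "count_space UNIV"]) auto
    finally show ?thesis .
  qed
  with fin' show ?case
    by (auto simp: measurable_count_space_eq2)
qed

text \<open>\<open>R\<close> is arbitrary because every subset of the range is measurable in the
  counting space. Any event that depends on \<open>z\<close> only through a tuple is thus
  measurable.\<close>

lemma sets_vtuple_Collect:
  assumes "finite (vtuple v k ` space N)"
    and "vtuple v k \<in> measurable N (count_space (vtuple v k ` space N))"
  shows "{z \<in> space N. R (vtuple v k z)} \<in> sets N"
proof -
  have "{z \<in> space N. R (vtuple v k z)} =
      vtuple v k -` {u \<in> vtuple v k ` space N. R u} \<inter> space N"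
    by auto
  also have "\<dots> \<in> sets N"
    by (rule measurable_sets[OF assms(2)]) auto
  finally show ?thesis .
qed

section \<open>Validity of sequential conditional p-values\<close>

text \<open>Kept unnormalised: with \<open>A\<close> a level set of a tuple and the level scaled by
  the mass of \<open>A\<close>, it serves for the conditional law on \<open>A\<close> without
  constructing that law.\<close>

lemma (in finite_measure) measure_pvalue_le:
  fixes T :: "'a \<Rightarrow> real"
  assumes "finite (T ` A)" and "0 \<le> \<alpha>"
    and meas: "\<And>z. z \<in> A \<Longrightarrow> {y \<in> A. T y \<le> T z} \<in> sets M"
  shows "measure M {z \<in> A. measure M {y \<in> A. T y \<le> T z} \<le> \<alpha>} \<le> \<alpha>"
proof -
  \<comment> \<open>The event is a lower level set of \<open>T\<close>, cut at the largest value that \<open>T\<close> takes on it.\<close>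
  let ?B = "{z \<in> A. measure M {y \<in> A. T y \<le> T z} \<le> \<alpha>}"
  show ?thesis
  proof (cases "?B = {}")
    case True
    with \<open>0 \<le> \<alpha>\<close> show ?thesis by (simp only: measure_empty)
  next
    case False
    have fin: "finite (T ` ?B)"
      by (rule finite_subset[OF _ assms(1)]) auto
    then have "Max (T ` ?B) \<in> T ` ?B"
      using False by (intro Max_in) auto
    then obtain z where z: "z \<in> ?B" "Max (T ` ?B) = T z"
      by blast
    have "T y \<le> T z" if "y \<in> ?B" for y
      using Max_ge[OF fin, of "T y"] that z by auto
    then have "measure M ?B \<le> measure M {y \<in> A. T y \<le> T z}"
      using z meas by (intro finite_measure_mono) auto
    with z show ?thesis by simp
  qed
qed

text \<open>\<open>M\<close> stands for the law of the treatment and \<open>T\<close> for the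
  statistics at a frozen schedule. Since \<open>p k\<close> looks at \<open>z\<close> only through
  its \<open>k\<close>-tuple, cutting the space by the \<open>n\<close>-tuple separates the last
  p-value from all earlier ones.\<close>

lemma (in prob_space) prob_sequential_pvalues_le:
  fixes v :: "nat \<Rightarrow> 'a \<Rightarrow> 'v" and T :: "nat \<Rightarrow> 'v list \<Rightarrow> real"
  defines "p \<equiv> \<lambda>k z. \<P>(y in M. T k (vtuple v k y) \<le> T k (vtuple v k z) \<bar>
                         vtuple v (k - 1) y = vtuple v (k - 1) z)"
  assumes v: "\<And>k. k \<in> {1..n} \<Longrightarrow> v k \<in> measurable M (count_space UNIV)"
    and fin: "\<And>k. k \<in> {1..n} \<Longrightarrow> finite (v k ` space M)"
    and \<alpha>: "\<And>k. k \<in> {1..n} \<Longrightarrow> 0 \<le> \<alpha> k"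
  shows "prob {z \<in> space M. \<forall>k\<in>{1..n}. p k z \<le> \<alpha> k} \<le> (\<Prod>k=1..n. \<alpha> k)"
  using v fin \<alpha>
proof (induction n)
  case 0
  show ?case by simp
next
  case (Suc n)
  define E where "E = (\<lambda>n. {z \<in> space M. \<forall>k\<in>{1..n}. p k z \<le> \<alpha> k})"
  define A where "A = (\<lambda>u. {z \<in> space M. vtuple v n z = u})"
  have V: "finite (vtuple v k ` space M)"
    "vtuple v k \<in> measurable M (count_space (vtuple v k ` space M))" if "k \<le> Suc n" for k
    using measurable_vtuple[of k v M] Suc.prems that by auto
  have V_sets: "{z \<in> space M. R (vtuple v k z)} \<in> events" if "k \<le> Suc n" for R k
    by (rule sets_vtuple_Collect[OF V[OF that]])
  have p_eq: "p k y = p k z" if "vtuple v k y = vtuple v k z" for k y z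
    using that vtuple_eq_mono[OF that, of "k - 1"] by (simp add: p_def)
  have E_eq: "y \<in> E m" if "z \<in> E m" "y \<in> space M" "vtuple v m y = vtuple v m z" for m y z
    using that(1,2) p_eq[OF vtuple_eq_mono[OF that(3)]] by (simp add: E_def)
  \<comment> \<open>Membership in \<open>E m\<close> is decided by the \<open>m\<close>-tuple, so
    \<open>E m\<close> is the preimage of a set of tuples.\<close>
  have E_sets: "E m \<in> events" if "m \<le> Suc n" for m
  proof -
    have "E m = {z \<in> space M. vtuple v m z \<in> vtuple v m ` E m}"
      using E_eq by (auto simp: E_def)
    then show ?thesis
      using V_sets[OF that, of "\<lambda>u. u \<in> vtuple v m ` E m"] by simp
  qed
  have A_sets: "A u \<in> events" for u
    unfolding A_def by (rule V_sets[of n "\<lambda>x. x = u"]) auto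
  have finE: "finite (vtuple v n ` E n)"
    by (rule finite_subset[OF _ V(1)[of n]]) (auto simp: E_def)
  have disj: "disjoint_family_on A I" for I
    by (auto simp: disjoint_family_on_def A_def)
  have E_Suc: "E (Suc n) = {z \<in> E n. p (Suc n) z \<le> \<alpha> (Suc n)}"
    by (auto simp: E_def atLeastAtMostSuc_conv)
  \<comment> \<open>\<open>E n\<close> is a disjoint union of whole cells \<open>A u\<close>; the
    last constraint can then be studied inside each cell.\<close>
  have E_n: "E n = (\<Union>u\<in>vtuple v n ` E n. A u)"
    using E_eq[of _ n] by (auto simp: A_def E_def)
  have step: "prob (E (Suc n) \<inter> A u) \<le> \<alpha> (Suc n) * prob (A u)" for u
  proof (cases "prob (A u) = 0")
    \<comment> \<open>On a null cell \<open>p (Suc n)\<close> is 0 by division by zero and excludes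
      no point, so the trivial bound by the mass of the cell is used.\<close>
    case True
    have "prob (E (Suc n) \<inter> A u) \<le> prob (A u)"
      by (intro finite_measure_mono A_sets) auto
    with True show ?thesis by simp
  next
    case False
    let ?T = "\<lambda>z. T (Suc n) (vtuple v (Suc n) z)"
    have sets: "{y \<in> A u. ?T y \<le> c} \<in> events" for c
    proof -
      have "{y \<in> A u. ?T y \<le> c} = A u \<inter> {y \<in> space M. ?T y \<le> c}"
        by (auto simp: A_def)
      then show ?thesis
        using A_sets V_sets[of "Suc n" "\<lambda>x. T (Suc n) x \<le> c"] by auto
    qed
    \<comment> \<open>As \<open>Suc n - 1 = n\<close>, the conditioning event is the cell
      itself.\<close>
    have p: "p (Suc n) z = prob {y \<in> A u. ?T y \<le> ?T z} / prob (A u)" if "z \<in> A u" for z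
      using that unfolding p_def cond_prob_def A_def
      by (auto intro!: arg_cong2[where f = "(/)"] arg_cong[where f = prob])
    have "prob (E (Suc n) \<inter> A u) \<le>
        prob {z \<in> A u. prob {y \<in> A u. ?T y \<le> ?T z} \<le> \<alpha> (Suc n) * prob (A u)}"
    proof (rule finite_measure_mono)
      show "E (Suc n) \<inter> A u \<subseteq> {z \<in> A u. prob {y \<in> A u. ?T y \<le> ?T z} \<le> \<alpha> (Suc n) * prob (A u)}"
        using False by (auto simp: E_Suc p pos_divide_le_eq zero_less_measure_iff)
      have "{z \<in> A u. prob {y \<in> A u. ?T y \<le> ?T z} \<le> \<alpha> (Suc n) * prob (A u)} =
          A u \<inter> {z \<in> space M. prob {y \<in> A u. ?T y \<le> ?T z} \<le> \<alpha> (Suc n) * prob (A u)}"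
        by (auto simp: A_def)
      then show "{z \<in> A u. prob {y \<in> A u. ?T y \<le> ?T z} \<le> \<alpha> (Suc n) * prob (A u)} \<in> events"
        using A_sets V_sets[of "Suc n" "\<lambda>x. prob {y \<in> A u. ?T y \<le> T (Suc n) x} \<le> \<alpha> (Suc n) * prob (A u)"]
        by auto
    qed
    also have "\<dots> \<le> \<alpha> (Suc n) * prob (A u)"
    proof (rule measure_pvalue_le)
      show "finite (?T ` A u)"
        by (rule finite_subset[of _ "T (Suc n) ` vtuple v (Suc n) ` space M"])
          (auto simp: V A_def)
      show "0 \<le> \<alpha> (Suc n) * prob (A u)"
        using Suc.prems(3) by simp
    qed (rule sets)
    finally show ?thesis .
  qed
  \<comment> \<open>\<open>E (Suc n)\<close> lies in \<open>E n\<close>, so only the cells of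
    \<open>E n\<close> contribute. Their full masses add up to \<open>prob (E n)\<close> again,
    where the induction hypothesis applies.\<close>
  have "prob (E (Suc n)) = prob (\<Union>u\<in>vtuple v n ` E n. E (Suc n) \<inter> A u)"
    using E_n by (intro arg_cong[where f = prob]) (auto simp: E_Suc)
  also have "\<dots> = (\<Sum>u\<in>vtuple v n ` E n. prob (E (Suc n) \<inter> A u))"
    using finE A_sets E_sets[of "Suc n"]
    by (intro finite_measure_finite_Union) (auto simp: disjoint_family_on_def A_def)
  also have "\<dots> \<le> (\<Sum>u\<in>vtuple v n ` E n. \<alpha> (Suc n) * prob (A u))"
    by (intro sum_mono step)
  also have "\<dots> = \<alpha> (Suc n) * prob (\<Union>u\<in>vtuple v n ` E n. A u)"
    using finE A_sets disj
    by (subst finite_measure_finite_Union) (auto simp: sum_distrib_left)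
  also have "\<dots> = \<alpha> (Suc n) * prob (E n)"
    using E_n by simp
  also have "\<dots> \<le> \<alpha> (Suc n) * (\<Prod>k=1..n. \<alpha> k)"
    using Suc by (intro mult_left_mono) (auto simp: E_def)
  finally show ?case
    by (simp add: E_def mult.commute)
qed

section \<open>Conditioning on an independent random element\<close>

text \<open>Independence is the product rule on measurable rectangles, and these determine the
  product of two sigma-finite measures.\<close>

lemma (in prob_space) distr_pair_indep_elements:
  assumes "indep_elements M N X R Y"
  shows "distr M N X \<Otimes>\<^sub>M distr M R Y = distr M (N \<Otimes>\<^sub>M R) (\<lambda>x. (X x, Y x))"
proof (rule pair_measure_eqI)
  have [measurable]: "X \<in> measurable M N" "Y \<in> measurable M R"
    and indep: "indep_set {X -` A \<inter> space M | A. A \<in> sets N} {Y -` B \<inter> space M | B. B \<in> sets R}"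
    using assms by (auto simp: indep_elements_def)
  show "sigma_finite_measure (distr M N X)" "sigma_finite_measure (distr M R Y)"
    by (auto intro!: prob_space_imp_sigma_finite prob_space_distr)
  show "sets (distr M N X \<Otimes>\<^sub>M distr M R Y) = sets (distr M (N \<Otimes>\<^sub>M R) (\<lambda>x. (X x, Y x)))"
    by (simp cong: sets_pair_measure_cong)
  fix A B assume "A \<in> sets (distr M N X)" "B \<in> sets (distr M R Y)"
  then have [measurable]: "A \<in> sets N" "B \<in> sets R" by auto
  have "(\<lambda>x. (X x, Y x)) -` (A \<times> B) \<inter> space M = (X -` A \<inter> space M) \<inter> (Y -` B \<inter> space M)"
    by auto
  moreover have "prob ((X -` A \<inter> space M) \<inter> (Y -` B \<inter> space M)) =
      prob (X -` A \<inter> space M) * prob (Y -` B \<inter> space M)"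
    using \<open>A \<in> sets N\<close> \<open>B \<in> sets R\<close> by (intro indep_setD[OF indep]) auto
  ultimately show "emeasure (distr M N X) A * emeasure (distr M R Y) B =
      emeasure (distr M (N \<Otimes>\<^sub>M R) (\<lambda>x. (X x, Y x))) (A \<times> B)"
    by (simp add: emeasure_distr emeasure_eq_measure ennreal_mult)
qed

text \<open>The measurability part of Fubini's theorem: a probability computed with \<open>y\<close>
  frozen must itself be a random variable in \<open>y\<close>.\<close>

lemma measurable_measure_section:
  assumes "prob_space D" and sets: "sets D = sets N"
    and S: "Measurable.pred (N \<Otimes>\<^sub>M R) (\<lambda>(z, y). S z y)"
  shows "(\<lambda>y. measure D {z \<in> space N. S z y}) \<in> borel_measurable R"
proof -
  interpret D: prob_space D by fact
  have eq: "space D = space N" using sets by (rule sets_eq_imp_space_eq)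
  have swap: "{(y, z) \<in> space (R \<Otimes>\<^sub>M D). S z y} \<in> sets (R \<Otimes>\<^sub>M D)"
  proof -
    have "(\<lambda>(y, z). (z, y)) \<in> measurable (R \<Otimes>\<^sub>M D) (N \<Otimes>\<^sub>M R)"
      using measurable_pair_swap'[of R N] by (simp cong: measurable_cong_sets add: sets)
    from measurable_compose[OF this S] show ?thesis
      by (simp add: pred_def split_beta')
  qed
  have "(\<lambda>y. emeasure D (Pair y -` {(y, z) \<in> space (R \<Otimes>\<^sub>M D). S z y})) \<in> borel_measurable R"
    by (rule D.measurable_emeasure_Pair[OF swap])
  also have "?this \<longleftrightarrow> (\<lambda>y. emeasure D {z \<in> space N. S z y}) \<in> borel_measurable R"
    by (intro measurable_cong arg_cong2[where f = emeasure]) (auto simp: space_pair_measure eq)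
  finally show ?thesis
    unfolding measure_def by measurable
qed

lemma subalgebra_generated_by: "X \<in> measurable M N \<Longrightarrow> subalgebra M (generated_by M X N)"
  unfolding subalgebra_def generated_by_def
  by (simp add: sets_image_in_sets)

text \<open>Freezing: by Fubini for the product of the two laws, both sides have the same integral
  over every event determined by \<open>Y\<close>. It is used for the copy against treatment and
  schedule, to compute the p-values, and for the treatment against the schedule, to get the joint
  bound.\<close>

lemma (in prob_space) cond_prob_sigma_indep:
  assumes indep: "indep_elements M N X R Y"
    and S: "Measurable.pred (N \<Otimes>\<^sub>M R) (\<lambda>(z, y). S z y)"
  shows "AE x in M. cond_prob_sigma M (generated_by M Y R) (\<lambda>x. S (X x) (Y x)) x =
    measure (distr M N X) {z \<in> space N. S z (Y x)}"
proof -
  have X [measurable]: "X \<in> measurable M N" and Y [measurable]: "Y \<in> measurable M R"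
    using indep by (auto simp: indep_elements_def)
  let ?F = "generated_by M Y R" and ?g = "\<lambda>y. measure (distr M N X) {z \<in> space N. S z y}"
  interpret DX: prob_space "distr M N X" by (rule prob_space_distr) simp
  interpret DY: prob_space "distr M R Y" by (rule prob_space_distr) simp
  interpret DXY: pair_prob_space "distr M N X" "distr M R Y" ..
  interpret F: finite_measure_subalgebra M ?F
    by unfold_locales (rule subalgebra_generated_by[OF Y])
  note S [measurable]
  have g [measurable]: "?g \<in> borel_measurable R"
    by (rule measurable_measure_section[OF DX.prob_space_axioms _ S]) simp
  have SXY [measurable]: "Measurable.pred M (\<lambda>x. S (X x) (Y x))"
    using measurable_compose[OF measurable_Pair[OF X Y] S] by simp
  show ?thesis unfolding cond_prob_sigma_def
  proof (rule F.real_cond_exp_charact)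
    fix A assume "A \<in> sets ?F"
    then obtain B where B [measurable]: "B \<in> sets R" and A: "A = Y -` B \<inter> space M"
      using measurable_space[OF Y] by (auto simp: generated_by_def sets_vimage_algebra2)
    \<comment> \<open>The restriction to \<open>A\<close> becomes a factor in \<open>y\<close>
      alone, so it leaves the inner integral over \<open>z\<close>.\<close>
    let ?f = "\<lambda>(z, y). indicator B y * indicator {(z, y). S z y} (z, y) :: real"
    have f: "?f \<in> borel_measurable (N \<Otimes>\<^sub>M R)"
      by measurable
    have "(\<integral>x\<in>A. indicator {x \<in> space M. S (X x) (Y x)} x \<partial>M) = (\<integral>x. ?f (X x, Y x) \<partial>M)"
      unfolding set_lebesgue_integral_def
      by (intro Bochner_Integration.integral_cong) (auto simp: A indicator_def)
    also have "\<dots> = (\<integral>p. ?f p \<partial>(distr M N X \<Otimes>\<^sub>M distr M R Y))"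
      unfolding distr_pair_indep_elements[OF indep] using f by (subst integral_distr) auto
    also have "\<dots> = (\<integral>y. (\<integral>z. ?f (z, y) \<partial>distr M N X) \<partial>distr M R Y)"
    proof -
      have "integrable (distr M N X \<Otimes>\<^sub>M distr M R Y) ?f"
        using f by (intro DXY.integrable_const_bound[of _ 1])
          (auto simp: indicator_def split: prod.splits cong: measurable_cong_sets sets_pair_measure_cong)
      from DXY.integral_snd[OF this] show ?thesis by simp
    qed
    also have "\<dots> = (\<integral>y. indicator B y * ?g y \<partial>distr M R Y)"
    proof (intro Bochner_Integration.integral_cong refl)
      fix y assume y: "y \<in> space (distr M R Y)"
      have "(\<integral>z. indicator {(z, y). S z y} (z, y) \<partial>distr M N X) =
          (\<integral>z. indicator {z \<in> space N. S z y} z \<partial>distr M N X :: real)"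
        by (intro Bochner_Integration.integral_cong) (auto simp: indicator_def)
      also have "\<dots> = ?g y"
        by (simp add: Int_absorb2)
      finally show "(\<integral>z. ?f (z, y) \<partial>distr M N X) = indicator B y * ?g y"
        by simp
    qed
    also have "\<dots> = (\<integral>x. indicator B (Y x) * ?g (Y x) \<partial>M)"
      by (rule integral_distr) measurable
    also have "\<dots> = (\<integral>x\<in>A. ?g (Y x) \<partial>M)"
      unfolding set_lebesgue_integral_def
      by (intro Bochner_Integration.integral_cong) (auto simp: A indicator_def)
    finally show "(\<integral>x\<in>A. indicator {x \<in> space M. S (X x) (Y x)} x \<partial>M) = (\<integral>x\<in>A. ?g (Y x) \<partial>M)" .
  next
    show "integrable M (indicator {x \<in> space M. S (X x) (Y x)} :: 'a \<Rightarrow> real)"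
      by (rule integrable_const_bound[of _ 1]) (auto simp: indicator_def)
    show "integrable M (\<lambda>x. ?g (Y x))"
      by (rule integrable_const_bound[of _ 1]) auto
    have "Y \<in> measurable ?F R"
      unfolding generated_by_def using measurable_space[OF Y] by (intro measurable_vimage_algebra1) auto
    from measurable_compose[OF this g] show "(\<lambda>x. ?g (Y x)) \<in> borel_measurable ?F" .
  qed
qed

section \<open>Explicit form of the p-values, joint bound and validity\<close>

theorem theorem2:
  fixes M :: "'a measure" and N :: "'z measure" and Q :: "'w measure"
    and Z Zs :: "'a \<Rightarrow> 'z" and W :: "'a \<Rightarrow> 'w" and \<pi> :: "'z \<Rightarrow> real"
    and v :: "nat \<Rightarrow> 'z \<Rightarrow> 'v" and t :: "nat \<Rightarrow> 'v list \<Rightarrow> 'w \<Rightarrow> real" and K :: nat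
  assumes "prob_space M"
    and "indep_elements M N Z Q W"
    and "distributed M N Z (\<lambda>z. ennreal (\<pi> z))"
    and "\<And>z. z \<in> space N \<Longrightarrow> \<pi> z > 0"
    and "indep_elements M N Zs (N \<Otimes>\<^sub>M Q) (\<lambda>x. (Z x, W x))"
    and "distr M N Zs = distr M N Z"
    and "K \<ge> 1"
    and "\<And>k. k \<in> {1..K} \<Longrightarrow> v k \<in> measurable N (count_space UNIV)"
    and "\<And>k. k \<in> {1..K} \<Longrightarrow> finite (v k ` space N)"
    and "\<And>k. k \<in> {1..K} \<Longrightarrow> (\<lambda>(vs, w). t k vs w)
               \<in> borel_measurable (count_space (vtuple v k ` space N) \<Otimes>\<^sub>M Q)"
  defines "P \<equiv> pvalue M N Q Z W Zs v t"
  shows "(\<forall>k\<in>{1..K}. AE x in M. P k x = pvalue_fun M Zs v t k (vtuple v k (Z x)) (W x)) \<and>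
         (\<forall>k\<in>{1..K}. \<forall>\<alpha>\<in>{0..1}. measure M {x \<in> space M. P k x \<le> \<alpha>} \<le> \<alpha>) \<and>
         (\<forall>\<alpha> :: nat \<Rightarrow> real. (\<forall>k\<in>{1..K}. \<alpha> k \<in> {0..1}) \<longrightarrow>
           (AE x in M. cond_prob_sigma M (generated_by M W Q) (\<lambda>y. \<forall>k\<in>{1..K}. P k y \<le> \<alpha> k) x
                         \<le> (\<Prod>k=1..K. \<alpha> k)))"
proof -
  interpret prob_space M by fact
  have Z [measurable]: "Z \<in> measurable M N" and W [measurable]: "W \<in> measurable M Q"
    and Zs [measurable]: "Zs \<in> measurable M N"
    using assms(2,5) by (auto simp: indep_elements_def)
  let ?D = "distr M N Z" and ?FZW = "generated_by M (\<lambda>x. (Z x, W x)) (N \<Otimes>\<^sub>M Q)"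
  interpret D: prob_space ?D by (rule prob_space_distr) simp
  have V: "finite (vtuple v k ` space N)"
    and V_meas [measurable]: "vtuple v k \<in> measurable N (count_space (vtuple v k ` space N))"
    if "k \<le> K" for k
    using measurable_vtuple[of k v N] assms(8,9) that by auto
  \<comment> \<open>Here \<open>y\<close> is the copy and the pair of treatment and schedule is
    frozen; \<open>A\<close> compares the statistics and \<open>B\<close> is the conditioning event.
    While \<open>P\<close> is built from versions of conditional expectations, \<open>p\<close> is
    explicit at every point.\<close>
  define A where "A = (\<lambda>k y p. t k (vtuple v k y) (snd p) \<le> t k (vtuple v k (fst p)) (snd p))"
  define B where "B = (\<lambda>k y (p :: 'z \<times> 'w). vtuple v (k - 1) y = vtuple v (k - 1) (fst p))"
  define p where "p = (\<lambda>k q. measure ?D {y \<in> space N. A k y q \<and> B k y q} /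
                              measure ?D {y \<in> space N. B k y q})"
  have t_meas: "(\<lambda>x. t k (vtuple v k (f x)) (g x)) \<in> borel_measurable L"
    if "k \<in> {1..K}" "f \<in> measurable L N" "g \<in> measurable L Q" for k f g and L :: "'l measure"
  proof -
    have "(\<lambda>x. (vtuple v k (f x), g x)) \<in> measurable L (count_space (vtuple v k ` space N) \<Otimes>\<^sub>M Q)"
      using that by (intro measurable_Pair measurable_compose[OF that(2) V_meas]) auto
    from measurable_compose[OF this assms(10)[OF that(1)]] show ?thesis by simp
  qed
  have A_meas: "Measurable.pred (N \<Otimes>\<^sub>M (N \<Otimes>\<^sub>M Q)) (\<lambda>(y, q). A k y q)" if "k \<in> {1..K}" for k
    unfolding A_def split_beta'
    unfolding pred_def by (intro borel_measurable_le t_meas[OF that]) simp_all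
  have B_meas: "Measurable.pred (N \<Otimes>\<^sub>M (N \<Otimes>\<^sub>M Q)) (\<lambda>(y, q). B k y q)" if "k \<in> {1..K}" for k
  proof -
    have k: "k - 1 \<le> K" using that by auto
    let ?C = "count_space (vtuple v (k - 1) ` space N)"
    have f: "(\<lambda>x. vtuple v (k - 1) (fst x)) \<in> measurable (N \<Otimes>\<^sub>M (N \<Otimes>\<^sub>M Q)) ?C"
      and g: "(\<lambda>x. vtuple v (k - 1) (fst (snd x))) \<in> measurable (N \<Otimes>\<^sub>M (N \<Otimes>\<^sub>M Q)) ?C"
      by (rule measurable_compose[OF _ V_meas[OF k]]; simp)+
    \<comment> \<open>Equality of two random tuples is split over their finitely many possible
      common values \<open>u\<close>.\<close>
    have "Measurable.pred (N \<Otimes>\<^sub>M (N \<Otimes>\<^sub>M Q)) (\<lambda>x. \<exists>u\<in>vtuple v (k - 1) ` space N.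
        vtuple v (k - 1) (fst x) = u \<and> vtuple v (k - 1) (fst (snd x)) = u)"
      by (intro pred_intros_finite pred_intros_logic pred_eq_const1[OF f] pred_eq_const1[OF g] V[OF k])
        auto
    also have "?this \<longleftrightarrow> ?thesis"
      unfolding B_def split_beta'
      by (intro measurable_cong) (auto simp: space_pair_measure)
    finally show ?thesis .
  qed
  have AB_meas: "Measurable.pred (N \<Otimes>\<^sub>M (N \<Otimes>\<^sub>M Q)) (\<lambda>(y, q). A k y q \<and> B k y q)"
    if "k \<in> {1..K}" for k
    using pred_intros_logic(3)[OF A_meas[OF that] B_meas[OF that]] by (simp add: split_beta')
  have p_meas [measurable]: "p k \<in> borel_measurable (N \<Otimes>\<^sub>M Q)" if "k \<in> {1..K}" for k
    unfolding p_def using A_meas[OF that] B_meas[OF that]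
    by (intro borel_measurable_divide measurable_measure_section[OF D.prob_space_axioms] AB_meas[OF that])
      simp_all
  \<comment> \<open>Numerator and denominator agree almost surely by freezing, so the quotients
    agree even where the denominator is 0. The law of the copy is that of \<open>Z\<close>.\<close>
  have P_p: "AE x in M. P k x = p k (Z x, W x)" if "k \<in> {1..K}" for k
    using cond_prob_sigma_indep[OF assms(5) AB_meas[OF that]]
      cond_prob_sigma_indep[OF assms(5) B_meas[OF that]]
    by eventually_elim
      (simp add: P_def pvalue_def cond_prob_event_sigma_def A_def B_def p_def assms(6))
  have P_meas [measurable]: "P k \<in> borel_measurable M" for k
    unfolding P_def pvalue_def cond_prob_event_sigma_def[abs_def] cond_prob_sigma_def
    by measurable
  have sets: "{y \<in> space N. A k y q \<and> B k y q} \<in> sets N" "{y \<in> space N. B k y q} \<in> sets N"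
    if "k \<in> {1..K}" for k q
  proof -
    from that have k: "k \<le> K" "k - 1 \<le> K" by auto
    show "{y \<in> space N. B k y q} \<in> sets N"
      unfolding B_def by (rule sets_vtuple_Collect[OF V[OF k(2)] V_meas[OF k(2)]])
    \<comment> \<open>The shorter tuple is a prefix of the \<open>k\<close>-tuple, so both
      conditions form one predicate of the latter.\<close>
    have "{y \<in> space N. A k y q \<and> B k y q} = {y \<in> space N. t k (vtuple v k y) (snd q)
        \<le> t k (vtuple v k (fst q)) (snd q) \<and> take (k - 1) (vtuple v k y) = vtuple v (k - 1) (fst q)}"
      by (simp add: A_def B_def take_vtuple)
    also have "\<dots> \<in> sets N"
      by (rule sets_vtuple_Collect[OF V[OF k(1)] V_meas[OF k(1)]])
    finally show "{y \<in> space N. A k y q \<and> B k y q} \<in> sets N" .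
  qed
  \<comment> \<open>\<open>pvalue_fun\<close> is stated with the copy, so the law of
    \<open>Z\<close> is traded for that of \<open>Zs\<close> and pulled back to
    \<open>M\<close>.\<close>
  have p_eq: "p k (z, w) = pvalue_fun M Zs v t k (vtuple v k z) w" if "k \<in> {1..K}" for k z w
    unfolding p_def pvalue_fun_def cond_prob_def assms(6)[symmetric]
    using that sets[OF that] measurable_space[OF Zs]
    by (simp add: measure_distr)
      (auto simp: A_def B_def take_vtuple intro!: arg_cong2[where f = "(/)"] arg_cong[where f = prob])
  \<comment> \<open>For frozen \<open>w\<close> this is the p-value of
    \<open>prob_sequential_pvalues_le\<close> under the law of \<open>Z\<close>, with
    \<open>t k u w\<close> as the statistic.\<close>
  have p_cond: "p k (z, w) = \<P>(y in ?D. t k (vtuple v k y) w \<le> t k (vtuple v k z) w \<bar>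
      vtuple v (k - 1) y = vtuple v (k - 1) z)" for k z w
    by (simp add: p_def cond_prob_def A_def B_def)
  have bound: "measure ?D {z \<in> space N. \<forall>k\<in>{1..K}. p k (z, w) \<le> \<alpha> k} \<le> (\<Prod>k=1..K. \<alpha> k)"
    if "\<forall>k\<in>{1..K}. \<alpha> k \<in> {0..1}" for \<alpha> :: "nat \<Rightarrow> real" and w
    using D.prob_sequential_pvalues_le[of K v \<alpha> "\<lambda>k u. t k u w"] assms(8,9) that
    by (simp add: p_cond)
  have joint: "AE x in M. cond_prob_sigma M (generated_by M W Q) (\<lambda>y. \<forall>k\<in>{1..K}. P k y \<le> \<alpha> k) x
      \<le> (\<Prod>k=1..K. \<alpha> k)" if \<alpha>: "\<forall>k\<in>{1..K}. \<alpha> k \<in> {0..1}" for \<alpha> :: "nat \<Rightarrow> real"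
  proof -
    interpret F: finite_measure_subalgebra M "generated_by M W Q"
      by unfold_locales (rule subalgebra_generated_by[OF W])
    have meas: "Measurable.pred (N \<Otimes>\<^sub>M Q) (\<lambda>(z, w). \<forall>k\<in>{1..K}. p k (z, w) \<le> \<alpha> k)"
      unfolding split_beta' prod.collapse by (intro pred_intros_finite borel_measurable_le p_meas) auto
    have meas': "Measurable.pred M (\<lambda>x. \<forall>k\<in>{1..K}. p k (Z x, W x) \<le> \<alpha> k)"
      using measurable_compose[OF measurable_Pair[OF Z W] meas] by simp
    \<comment> \<open>After replacing \<open>P\<close> by \<open>p\<close>, the event is an explicit
      condition on \<open>(Z, W)\<close>, to which freezing of \<open>W\<close> applies;
      \<open>bound\<close> then holds at each value of \<open>W\<close>.\<close>
    have "AE x in M. \<forall>k\<in>{1..K}. P k x = p k (Z x, W x)"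
      using P_p by (intro AE_finite_allI) auto
    then have "AE x in M. cond_prob_sigma M (generated_by M W Q) (\<lambda>y. \<forall>k\<in>{1..K}. P k y \<le> \<alpha> k) x =
        cond_prob_sigma M (generated_by M W Q) (\<lambda>y. \<forall>k\<in>{1..K}. p k (Z y, W y) \<le> \<alpha> k) x"
      unfolding cond_prob_sigma_def
    proof (intro F.real_cond_exp_cong)
      assume "AE x in M. \<forall>k\<in>{1..K}. P k x = p k (Z x, W x)"
      then show "AE x in M. (indicator {x \<in> space M. \<forall>k\<in>{1..K}. P k x \<le> \<alpha> k} x :: real) =
          indicator {x \<in> space M. \<forall>k\<in>{1..K}. p k (Z x, W x) \<le> \<alpha> k} x"
        by eventually_elim (auto simp: indicator_def)
    qed (use meas' in measurable)
    with cond_prob_sigma_indep[OF assms(2) meas] show ?thesis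
      by eventually_elim (use bound[OF \<alpha>] in simp)
  qed
  have valid: "measure M {x \<in> space M. P k x \<le> \<alpha>} \<le> \<alpha>" if k: "k \<in> {1..K}" and \<alpha>: "\<alpha> \<in> {0..1}" for k \<alpha>
  proof -
    interpret F: finite_measure_subalgebra M "generated_by M W Q"
      by unfold_locales (rule subalgebra_generated_by[OF W])
    \<comment> \<open>The other levels are set to 1, which imposes no constraint.\<close>
    define a where "a = (\<lambda>j. if j = k then \<alpha> else 1)"
    let ?S = "{x \<in> space M. \<forall>j\<in>{1..K}. P j x \<le> a j}"
    have S [measurable]: "?S \<in> events" by measurable
    have int: "integrable M (indicator ?S :: 'a \<Rightarrow> real)"
      by (rule integrable_real_indicator[OF S]) (simp add: emeasure_eq_measure)
    \<comment> \<open>This makes the levels 1 vacuous for \<open>p\<close>, hence almost surely for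
      \<open>P\<close>. A null denominator gives the value 0.\<close>
    have p_le: "p j q \<le> 1" if "j \<in> {1..K}" for j q
    proof -
      have "D.prob {y \<in> space N. A j y q \<and> B j y q} \<le> D.prob {y \<in> space N. B j y q}"
        by (rule D.finite_measure_mono) (use sets(2)[OF that, of q] in auto)
      then show ?thesis
        by (cases "D.prob {y \<in> space N. B j y q} = 0")
          (simp_all add: p_def zero_less_measure_iff)
    qed
    have "AE x in M. \<forall>j\<in>{1..K}. P j x = p j (Z x, W x)"
      using P_p by (intro AE_finite_allI) auto
    then have "AE x in M. x \<in> {x \<in> space M. P k x \<le> \<alpha>} \<longleftrightarrow> x \<in> ?S"
      by eventually_elim (use k p_le in \<open>auto simp: a_def\<close>)
    then have "measure M {x \<in> space M. P k x \<le> \<alpha>} = measure M ?S"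
      by (intro finite_measure_eq_AE) auto
    also have "\<dots> = (\<integral>x. indicator ?S x \<partial>M)" by simp
    \<comment> \<open>Integrating the conditional probability gives the unconditional one, so the
      joint bound carries over; its product collapses to \<alpha>.\<close>
    also have "\<dots> = (\<integral>x. cond_prob_sigma M (generated_by M W Q) (\<lambda>y. \<forall>j\<in>{1..K}. P j y \<le> a j) x \<partial>M)"
      unfolding cond_prob_sigma_def
      by (rule F.real_cond_exp_int(2)[OF int, symmetric])
    also have "\<dots> \<le> (\<integral>x. (\<Prod>j=1..K. a j) \<partial>M)"
      using joint[of a] \<alpha> unfolding cond_prob_sigma_def
      by (intro integral_mono_AE F.real_cond_exp_int(1)[OF int]) (auto simp: a_def)
    also have "\<dots> = \<alpha>"
      using k by (simp add: a_def prob_space prod.delta)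
    finally show ?thesis .
  qed
  show ?thesis
    using P_p p_eq joint valid by auto
qed

end
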